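(* Let $\delta\in(0,1)$ and $\alpha\ge2$, and assume that (A1) and (A3) (spelled out in the context) are satisfied. Let $\hat{\beta}$ be a solution of $$\min_{\beta\in\mathbb{R}^p:\ \|\beta\|_1\le 2R}\ \frac1n\sum_{i=1}^n f(\langle x_i,\beta\rangle;y_i)+\lambda\|\beta\|_1$$ with parameter $\lambda=12\,\alpha L M\sqrt{\frac{\log(2pe/k^* )}{n}\log(2/\delta)}$. Then, with probability at least $1-\frac{\delta}{2}$, $$h:=\hat{\beta}-\beta^*\in\Lambda\left(S_0,\ \gamma_1:=\frac{\alpha}{\alpha-1},\ \gamma_2:=\frac{\sqrt{k^*}}{\alpha-1}\right),$$ where $S_0$ is the subset of indices of the $k^*$ highest (in absolute value) coefficients of $h$.
   Context: Setting. $(x_i,y_i)_{i=1}^n$, with $(x_i,y_i)\in\mathbb{R}^p\times\mathcal{Y}$, are training data drawn from an unknown distribution $\mathbb{P}$ of a generic pair $(x,y)$; $x_{ij}$ is the $j$-th entry of $x_i$. $f(\cdot;y)$ is a loss function and $\mathcal{L}(\beta)=\mathbb{E}\,f(\langle x,\beta\rangle;y)$ is the theoretical loss. $\beta^*\in\mathrm{argmin}_{\beta\in\mathbb{R}^p}\mathcal{L}(\beta)$ is a theoretical minimizer, $k^*=\|\beta^*\|_0$ is its number of nonzero entries and $R=\|\beta^*\|_1$; it is assumed that $R\ge1$. Here $e=\exp(1)$. For $S\subset\{1,\dots,p\}$, $\Lambda(S,\gamma_1,\gamma_2)=\{z\in\mathbb{R}^p:\ \|z_{S^c}\|_1\le\gamma_1\|z_S\|_1+\gamma_2\|z_S\|_2\}$,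 where $z_S$ is the restriction of $z$ to the coordinates in $S$. A random variable $Z$ is called sub-Gaussian with variance $\sigma^2>0$, written $Z\sim\mathrm{subG}(\sigma^2)$, if $\mathbb{E}(Z)=0$ and $\mathbb{P}(|Z|>t)\le 2\exp(-t^2/(2\sigma^2))$ for all $t>0$. (A1) For every $y$, $f(\cdot;y)$ is non-negative, convex and Lipschitz with constant $L$; moreover $\partial f(\cdot;y)$ denotes a subgradient, i.e. $f(t_2;y)-f(t_1;y)\ge\partial f(t_1;y)(t_2-t_1)$ for all $t_1,t_2$. (A3) There is $M>0$ such that $\sum_{i=1}^n\partial f(\langle x_i,\beta^*\rangle;y_i)\,x_{ij}\sim\mathrm{subG}(nL^2M^2)$ for every $j\in\{1,\dots,p\}$. *)

theory Defs
  imports "HOL-Probability.Probability"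
begin

definition l0norm :: "real ^ 'p::finite \<Rightarrow> nat" where
  "l0norm z = card {j. z $ j \<noteq> 0}"

definition l1norm :: "real ^ 'p::finite \<Rightarrow> real" where
  "l1norm z = (\<Sum>j\<in>UNIV. \<bar>z $ j\<bar>)"

(* The restriction of z to S is kept in the ambient space, padded with zeros;
   this changes neither its l1 nor its Euclidean norm. *)
definition restrict_coords :: "'p set \<Rightarrow> real ^ 'p \<Rightarrow> real ^ 'p::finite" where
  "restrict_coords S z = (\<chi> j. if j \<in> S then z $ j else 0)"

definition cone_Lambda :: "'p set \<Rightarrow> real \<Rightarrow> real \<Rightarrow> (real ^ 'p::finite) set" where
  "cone_Lambda S \<gamma>\<^sub>1 \<gamma>\<^sub>2 =
     {z. l1norm (restrict_coords (- S) z)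
           \<le> \<gamma>\<^sub>1 * l1norm (restrict_coords S z) + \<gamma>\<^sub>2 * norm (restrict_coords S z)}"

(* With ties among the absolute values there may be several such sets S. *)
definition top_coords :: "nat \<Rightarrow> real ^ 'p::finite \<Rightarrow> 'p set \<Rightarrow> bool" where
  "top_coords k z S \<longleftrightarrow> card S = k \<and> (\<forall>i\<in>S. \<forall>j\<in>- S. \<bar>z $ j\<bar> \<le> \<bar>z $ i\<bar>)"

(* The variance parameter v stands for sigma^2. *)
definition subG :: "'w measure \<Rightarrow> ('w \<Rightarrow> real) \<Rightarrow> real \<Rightarrow> bool" where
  "subG M Z v \<longleftrightarrow>
     v > 0 \<and> integrable M Z \<and> integral\<^sup>L M Z = 0 \<and>
     (\<forall>t>0. measure M {\<omega> \<in> space M. \<bar>Z \<omega>\<bar> > t} \<le> 2 * exp (- t\<^sup>2 / (2 * v)))"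

(* The loss is non-negative, so its expectation is taken in [0, infinity]
   and no integrability has to be assumed. *)
definition theoretical_loss ::
  "((real ^ 'p::finite) \<times> 'y) measure \<Rightarrow> (real \<Rightarrow> 'y \<Rightarrow> real) \<Rightarrow> real ^ 'p \<Rightarrow> ennreal" where
  "theoretical_loss P f \<beta> = (\<integral>\<^sup>+ (x, y). ennreal (f (x \<bullet> \<beta>) y) \<partial>P)"

definition penalized_loss ::
  "nat \<Rightarrow> (nat \<Rightarrow> real ^ 'p::finite) \<Rightarrow> (nat \<Rightarrow> 'y) \<Rightarrow> (real \<Rightarrow> 'y \<Rightarrow> real) \<Rightarrow> real
     \<Rightarrow> real ^ 'p \<Rightarrow> real" where
  "penalized_loss n x y f l \<beta> = 1 / real n * (\<Sum>i<n. f (x i \<bullet> \<beta>) (y i)) + l * l1norm \<beta>"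

end

theory Submission
  imports Defs
begin

text \<open>
  Minimality of \<open>\<beta>hat\<close> and the subgradient inequality give, for \<open>h = \<beta>hat - \<beta>s\<close> and the averaged
  score \<open>g\<close> at \<open>\<beta>s\<close>, the bound \<open>l (\<parallel>\<beta>hat\<parallel>\<^sub>1 - \<parallel>\<beta>s\<parallel>\<^sub>1) \<le> \<Sum>j. \<bar>g\<^sub>j\<bar> \<bar>h\<^sub>j\<bar>\<close>. A single event controls all
  sums of \<open>k\<close> squared scores: if \<open>V\<^sub>j\<close> is the normalized square of \<open>g\<^sub>j\<close>, Markov's inequality bounds
  \<open>\<Sum>j. exp (V\<^sub>j / 2)\<close>, and by concavity of the logarithm \<open>\<Sum>j\<in>A. V\<^sub>j\<close> is at most of order
  \<open>k ln (p / (k \<delta>))\<close> whenever \<open>card A = k\<close>. Rearranging the large scores onto the largest coordinates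
  of \<open>h\<close> then yields \<open>\<Sum>j. \<bar>g\<^sub>j\<bar> \<bar>h\<^sub>j\<bar> \<le> l / \<alpha> (\<parallel>h\<^bsub>-S\<^sub>0\<^esub>\<parallel>\<^sub>1 + sqrt k \<parallel>h\<^bsub>S\<^sub>0\<^esub>\<parallel>\<^sub>2)\<close>, which is the cone
  condition.
\<close>

section \<open>Rearrangement onto the largest coordinates of \<open>h\<close>\<close>

text \<open>Deleting the common part leaves at most as many indices of \<open>T\<close> as of
  \<open>S\<close>. Any injection between the rests works, as every entry on \<open>S\<close>
  dominates every entry off \<open>S\<close>.\<close>

lemma top_coords_injection:
  fixes h :: "real ^ 'p::finite"
  assumes top: "top_coords k h S" and "card T \<le> k"
  obtains \<pi> where "inj_on \<pi> (T - S)" "\<pi> ` (T - S) \<subseteq> S - T"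
    "\<And>j. j \<in> T - S \<Longrightarrow> \<bar>h $ j\<bar> \<le> \<bar>h $ \<pi> j\<bar>"
proof -
  have cS: "card S = k" using top by (simp add: top_coords_def)
  have "card (T - S) = card T - card (T \<inter> S)" "card (S - T) = card S - card (T \<inter> S)"
    by (simp_all add: card_Diff_subset_Int Int_commute)
  with cS assms(2) have "card (T - S) \<le> card (S - T)" by simp
  then obtain \<pi> where \<pi>: "\<pi> ` (T - S) \<subseteq> S - T" "inj_on \<pi> (T - S)"
    using card_le_inj[of "T - S" "S - T"] by auto
  moreover have "\<bar>h $ j\<bar> \<le> \<bar>h $ \<pi> j\<bar>" if "j \<in> T - S" for j
  proof -
    have "\<pi> j \<in> S" using \<pi>(1) that by blast
    with that top show ?thesis by (auto simp: top_coords_def)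
  qed
  ultimately show ?thesis using that by blast
qed

lemma sum_le_sum_top_coords:
  fixes h :: "real ^ 'p::finite"
  assumes "top_coords k h S" "card T \<le> k"
  shows "(\<Sum>j\<in>T. \<bar>h $ j\<bar>) \<le> (\<Sum>j\<in>S. \<bar>h $ j\<bar>)"
proof -
  obtain \<pi> where \<pi>: "inj_on \<pi> (T - S)" "\<pi> ` (T - S) \<subseteq> S - T"
    "\<And>j. j \<in> T - S \<Longrightarrow> \<bar>h $ j\<bar> \<le> \<bar>h $ \<pi> j\<bar>"
    using top_coords_injection[OF assms] by blast
  have "(\<Sum>j\<in>T - S. \<bar>h $ j\<bar>) \<le> (\<Sum>j\<in>T - S. \<bar>h $ \<pi> j\<bar>)"
    using \<pi>(3) by (rule sum_mono)
  also have "\<dots> = (\<Sum>j\<in>\<pi> ` (T - S). \<bar>h $ j\<bar>)"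
    using \<pi>(1) by (simp add: sum.reindex)
  also have "\<dots> \<le> (\<Sum>j\<in>S - T. \<bar>h $ j\<bar>)"
    using \<pi>(2) by (intro sum_mono2) auto
  finally have "(\<Sum>j\<in>T - S. \<bar>h $ j\<bar>) \<le> (\<Sum>j\<in>S - T. \<bar>h $ j\<bar>)" .
  moreover have "(\<Sum>j\<in>T. \<bar>h $ j\<bar>) = (\<Sum>j\<in>T - S. \<bar>h $ j\<bar>) + (\<Sum>j\<in>S \<inter> T. \<bar>h $ j\<bar>)"
    using sum.Int_Diff[of T "\<lambda>j. \<bar>h $ j\<bar>" S] by (simp add: Int_commute)
  moreover have "(\<Sum>j\<in>S. \<bar>h $ j\<bar>) = (\<Sum>j\<in>S - T. \<bar>h $ j\<bar>) + (\<Sum>j\<in>S \<inter> T. \<bar>h $ j\<bar>)"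
    using sum.Int_Diff[of S "\<lambda>j. \<bar>h $ j\<bar>" T] by simp
  ultimately show ?thesis by linarith
qed

text \<open>
  The coordinates with \<open>g\<^sub>j > t\<close> outside \<open>S\<close> are moved injectively onto coordinates of \<open>S\<close> where
  \<open>g \<le> t\<close> and \<open>h\<close> is larger; Cauchy-Schwarz is applied to the exchanged index set \<open>A\<close>.
\<close>

lemma sum_mult_le_top_coords:
  fixes h :: "real ^ 'p::finite" and g :: "'p \<Rightarrow> real"
  assumes top: "top_coords k h S" and "0 < k" and t: "0 \<le> t"
    and g: "\<And>j. 0 \<le> g j"
    and sq: "\<And>A. card A = k \<Longrightarrow> (\<Sum>j\<in>A. (g j)\<^sup>2) \<le> real k * t\<^sup>2"
  shows "(\<Sum>j\<in>UNIV. g j * \<bar>h $ j\<bar>)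
     \<le> t * ((\<Sum>j\<in>- S. \<bar>h $ j\<bar>) + sqrt k * sqrt (\<Sum>j\<in>S. (h $ j)\<^sup>2))"
proof -
  define T where "T = {j. t < g j}"
  have cS: "card S = k" using top by (simp add: top_coords_def)
  \<comment> \<open>Otherwise \<open>T\<close> contains a \<open>k\<close>-set violating
    \<open>sq\<close>; strictness uses that it is nonempty.\<close>
  have "card T \<le> k"
  proof (rule ccontr)
    assume "\<not> card T \<le> k"
    then obtain A where A: "A \<subseteq> T" "card A = k"
      by (meson nat_le_linear obtain_subset_with_card_n)
    have "A \<noteq> {}" using A \<open>0 < k\<close> by auto
    then have "(\<Sum>j\<in>A. t\<^sup>2) < (\<Sum>j\<in>A. (g j)\<^sup>2)"
      using A(1) t by (intro sum_strict_mono) (auto simp: T_def intro!: power_strict_mono)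
    then show False using sq[OF A(2)] A(2) by simp
  qed
  then obtain \<pi> where \<pi>: "inj_on \<pi> (T - S)" "\<pi> ` (T - S) \<subseteq> S - T"
    "\<And>j. j \<in> T - S \<Longrightarrow> \<bar>h $ j\<bar> \<le> \<bar>h $ \<pi> j\<bar>"
    using top_coords_injection[OF top] by blast
  let ?Q = "\<pi> ` (T - S)"
  define A where "A = (S - ?Q) \<union> (T - S)"
  \<comment> \<open>On \<open>A\<close>, \<open>u\<close> rearranges the absolute values of
    \<open>h\<close> on \<open>S\<close>, which is why the square sums agree in
    \<open>uA\<close>.\<close>
  define u where "u j = (if j \<in> S then \<bar>h $ j\<bar> else \<bar>h $ \<pi> j\<bar>)" for j
  have QS: "?Q \<subseteq> S" using \<pi>(2) by blast
  have splitS: "(\<Sum>j\<in>S. F j) = (\<Sum>j\<in>S - ?Q. F j) + (\<Sum>j\<in>T - S. F (\<pi> j))" for F :: "'p \<Rightarrow> real"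
  proof -
    have "(\<Sum>j\<in>S. F j) = (\<Sum>j\<in>S - ?Q. F j) + (\<Sum>j\<in>?Q. F j)"
      by (rule sum.subset_diff[OF QS]) simp
    then show ?thesis using \<pi>(1) by (simp add: sum.reindex)
  qed
  have splitA: "(\<Sum>j\<in>A. F j) = (\<Sum>j\<in>S - ?Q. F j) + (\<Sum>j\<in>T - S. F j)" for F :: "'p \<Rightarrow> real"
    unfolding A_def by (rule sum.union_disjoint) auto
  have "real (card A) = real (card S)"
    using splitS[of "\<lambda>_. 1"] splitA[of "\<lambda>_. 1"] by simp
  then have cA: "card A = k" using cS by simp
  have uA: "(\<Sum>j\<in>A. (u j)\<^sup>2) = (\<Sum>j\<in>S. (h $ j)\<^sup>2)"
    unfolding splitS splitA by (simp add: u_def)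
  have "(\<Sum>j\<in>- S. g j * \<bar>h $ j\<bar>)
      = (\<Sum>j\<in>- S. t * \<bar>h $ j\<bar>) + (\<Sum>j\<in>- S. (g j - t) * \<bar>h $ j\<bar>)"
    by (simp add: sum.distrib[symmetric] algebra_simps)
  \<comment> \<open>Terms with \<open>g j \<le> t\<close> are nonpositive; in the others the weight
    \<open>g j - t\<close> is positive, so the larger entry at \<open>\<pi> j\<close> may be
    used.\<close>
  also have "(\<Sum>j\<in>- S. (g j - t) * \<bar>h $ j\<bar>) \<le> (\<Sum>j\<in>T - S. (g j - t) * \<bar>h $ \<pi> j\<bar>)"
  proof -
    have "(\<Sum>j\<in>- S. (g j - t) * \<bar>h $ j\<bar>) 
        = (\<Sum>j\<in>- S - (T - S). (g j - t) * \<bar>h $ j\<bar>) + (\<Sum>j\<in>T - S. (g j - t) * \<bar>h $ j\<bar>)"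
      by (rule sum.subset_diff) auto
    also have "(\<Sum>j\<in>- S - (T - S). (g j - t) * \<bar>h $ j\<bar>) \<le> 0"
      by (intro sum_nonpos mult_nonpos_nonneg) (auto simp: T_def)
    also have "(\<Sum>j\<in>T - S. (g j - t) * \<bar>h $ j\<bar>) \<le> (\<Sum>j\<in>T - S. (g j - t) * \<bar>h $ \<pi> j\<bar>)"
      using \<pi>(3) by (intro sum_mono mult_left_mono) (auto simp: T_def)
    finally show ?thesis by simp
  qed
  finally have 1: "(\<Sum>j\<in>- S. g j * \<bar>h $ j\<bar>)
      \<le> t * (\<Sum>j\<in>- S. \<bar>h $ j\<bar>) + (\<Sum>j\<in>T - S. (g j - t) * \<bar>h $ \<pi> j\<bar>)"
    by (simp add: sum_distrib_left)
  \<comment> \<open>Images under \<open>\<pi>\<close> lie outside \<open>T\<close>, so their scores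
    are at most \<open>t\<close>. This \<open>t\<close> and the excess \<open>g j - t\<close> add up
    to the full weight \<open>g j\<close>.\<close>
  have "(\<Sum>j\<in>T - S. g (\<pi> j) * \<bar>h $ \<pi> j\<bar>) \<le> (\<Sum>j\<in>T - S. t * \<bar>h $ \<pi> j\<bar>)"
    using \<pi>(2) by (intro sum_mono mult_right_mono) (auto simp: T_def image_subset_iff not_less)
  moreover have "(\<Sum>j\<in>T - S. (g j - t) * \<bar>h $ \<pi> j\<bar>) + (\<Sum>j\<in>T - S. t * \<bar>h $ \<pi> j\<bar>)
      = (\<Sum>j\<in>T - S. g j * u j)"
    by (simp add: sum.distrib[symmetric] algebra_simps u_def)
  moreover have "(\<Sum>j\<in>S. g j * \<bar>h $ j\<bar>)
      = (\<Sum>j\<in>S - ?Q. g j * u j) + (\<Sum>j\<in>T - S. g (\<pi> j) * \<bar>h $ \<pi> j\<bar>)"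
    unfolding splitS by (simp add: u_def)
  ultimately have 2: "(\<Sum>j\<in>S. g j * \<bar>h $ j\<bar>) + (\<Sum>j\<in>T - S. (g j - t) * \<bar>h $ \<pi> j\<bar>)
      \<le> (\<Sum>j\<in>A. g j * u j)"
    unfolding splitA by linarith
  have "(\<Sum>j\<in>A. g j * u j) \<le> L2_set g A * L2_set u A"
    using L2_set_mult_ineq[of g u A] g by (simp add: u_def abs_mult if_distrib cong: if_cong)
  also have "\<dots> \<le> sqrt (real k * t\<^sup>2) * sqrt (\<Sum>j\<in>S. (h $ j)\<^sup>2)"
    unfolding L2_set_def uA using sq[OF cA]
    by (intro mult_right_mono real_sqrt_le_mono) (auto intro: sum_nonneg)
  also have "\<dots> = t * (sqrt k * sqrt (\<Sum>j\<in>S. (h $ j)\<^sup>2))"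
    using t by (simp add: real_sqrt_mult)
  finally have 3: "(\<Sum>j\<in>A. g j * u j) \<le> t * (sqrt k * sqrt (\<Sum>j\<in>S. (h $ j)\<^sup>2))" .
  have "(\<Sum>j\<in>UNIV. g j * \<bar>h $ j\<bar>)
      = (\<Sum>j\<in>- S. g j * \<bar>h $ j\<bar>) + (\<Sum>j\<in>S. g j * \<bar>h $ j\<bar>)"
    using sum.subset_diff[of S UNIV "\<lambda>j. g j * \<bar>h $ j\<bar>"] by (simp add: Compl_eq_Diff_UNIV)
  with 1 2 3 show ?thesis unfolding distrib_left by linarith
qed

section \<open>Restricted norms and the deterministic cone condition\<close>

lemma l1norm_restrict_coords: "l1norm (restrict_coords S z) = (\<Sum>j\<in>S. \<bar>z $ j\<bar>)"
proof -
  have "l1norm (restrict_coords S z) = (\<Sum>j\<in>UNIV. if j \<in> S then \<bar>z $ j\<bar> else 0)"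
    unfolding l1norm_def restrict_coords_def by (intro sum.cong) auto
  then show ?thesis by (simp add: sum.If_cases)
qed

lemma norm_restrict_coords: "norm (restrict_coords S z) = sqrt (\<Sum>j\<in>S. (z $ j)\<^sup>2)"
proof -
  have "(\<Sum>j\<in>UNIV. (norm (restrict_coords S z $ j))\<^sup>2)
      = (\<Sum>j\<in>UNIV. if j \<in> S then (z $ j)\<^sup>2 else 0)"
    unfolding restrict_coords_def by (intro sum.cong) auto
  then show ?thesis by (simp add: norm_vec_def L2_set_def sum.If_cases)
qed

text \<open>For the support \<open>T\<close> of \<open>\<beta>\<close> in place of \<open>S\<close>
  this is the triangle inequality. Passing to \<open>S\<close> only lowers the left side, since
  \<open>S\<close> carries at least the l1 mass that \<open>T\<close> does and the total is
  fixed.\<close>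

lemma l1norm_diff_le_top_coords:
  fixes b \<beta> :: "real ^ 'p::finite"
  assumes top: "top_coords (l0norm \<beta>) (b - \<beta>) S"
  shows "(\<Sum>j\<in>- S. \<bar>(b - \<beta>) $ j\<bar>) - (\<Sum>j\<in>S. \<bar>(b - \<beta>) $ j\<bar>) \<le> l1norm b - l1norm \<beta>"
proof -
  define T where "T = {j. \<beta> $ j \<noteq> 0}"
  let ?h = "b - \<beta>"
  have split: "(\<Sum>j\<in>UNIV. F j) = (\<Sum>j\<in>- U. F j) + (\<Sum>j\<in>U. F j)" for U and F :: "'p \<Rightarrow> real"
    using sum.subset_diff[of U UNIV F] by (simp add: Compl_eq_Diff_UNIV)
  have TS: "(\<Sum>j\<in>T. \<bar>?h $ j\<bar>) \<le> (\<Sum>j\<in>S. \<bar>?h $ j\<bar>)"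
    using sum_le_sum_top_coords[OF top] by (simp add: T_def l0norm_def)
  have "(\<Sum>j\<in>- T. \<bar>?h $ j\<bar>) = (\<Sum>j\<in>- T. \<bar>b $ j\<bar> - \<bar>\<beta> $ j\<bar>)"
    by (intro sum.cong) (auto simp: T_def)
  moreover have "(\<Sum>j\<in>T. - \<bar>?h $ j\<bar>) \<le> (\<Sum>j\<in>T. \<bar>b $ j\<bar> - \<bar>\<beta> $ j\<bar>)"
    by (intro sum_mono) simp
  ultimately have "(\<Sum>j\<in>- T. \<bar>?h $ j\<bar>) - (\<Sum>j\<in>T. \<bar>?h $ j\<bar>)
      \<le> (\<Sum>j\<in>UNIV. \<bar>b $ j\<bar> - \<bar>\<beta> $ j\<bar>)"
    unfolding split[where U = T] by (simp add: sum_negf)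
  then have "(\<Sum>j\<in>- T. \<bar>?h $ j\<bar>) - (\<Sum>j\<in>T. \<bar>?h $ j\<bar>) \<le> l1norm b - l1norm \<beta>"
    by (simp add: l1norm_def sum_subtractf)
  with TS split[of "\<lambda>j. \<bar>?h $ j\<bar>" S] split[of "\<lambda>j. \<bar>?h $ j\<bar>" T] show ?thesis
    by linarith
qed

text \<open>The deterministic half: \<open>g\<close> stands for the absolute averaged scores,
  \<open>t\<close> for the penalty level over \<open>\<alpha>\<close>. The two bounds combine to
  \<open>\<alpha> * (u - v) \<le> u + w\<close>, and solving for \<open>u\<close> yields the
  denominators \<open>\<alpha> - 1\<close>.\<close>

lemma cone_Lambda_of_score_bound:
  fixes b \<beta> :: "real ^ 'p::finite"
  assumes top: "top_coords (l0norm \<beta>) (b - \<beta>) S" and pos: "0 < l0norm \<beta>"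
    and t: "0 < t" and \<alpha>: "1 < \<alpha>"
    and g: "\<And>j. 0 \<le> g j"
    and sq: "\<And>A. card A = l0norm \<beta> \<Longrightarrow> (\<Sum>j\<in>A. (g j)\<^sup>2) \<le> real (l0norm \<beta>) * t\<^sup>2"
    and basic: "\<alpha> * t * (l1norm b - l1norm \<beta>) \<le> (\<Sum>j\<in>UNIV. g j * \<bar>(b - \<beta>) $ j\<bar>)"
  shows "b - \<beta> \<in> cone_Lambda S (\<alpha> / (\<alpha> - 1)) (sqrt (l0norm \<beta>) / (\<alpha> - 1))"
proof -
  define u v w where "u = (\<Sum>j\<in>- S. \<bar>(b - \<beta>) $ j\<bar>)" and "v = (\<Sum>j\<in>S. \<bar>(b - \<beta>) $ j\<bar>)"
    and "w = sqrt (l0norm \<beta>) * sqrt (\<Sum>j\<in>S. ((b - \<beta>) $ j)\<^sup>2)"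
  have "\<alpha> * t * (u - v) \<le> \<alpha> * t * (l1norm b - l1norm \<beta>)"
    using l1norm_diff_le_top_coords[OF top] t \<alpha> unfolding u_def v_def
    by (intro mult_left_mono) auto
  also note basic
  also have "(\<Sum>j\<in>UNIV. g j * \<bar>(b - \<beta>) $ j\<bar>) \<le> t * (u + w)"
    unfolding u_def w_def by (rule sum_mult_le_top_coords[OF top pos _ g sq]) (use t in auto)
  finally have "t * (\<alpha> * (u - v)) \<le> t * (u + w)" by (simp add: ac_simps)
  then have "\<alpha> * (u - v) \<le> u + w" using t by simp
  then have "(\<alpha> - 1) * u \<le> \<alpha> * v + w" by (simp add: algebra_simps)
  then have "u \<le> (\<alpha> * v + w) / (\<alpha> - 1)" using \<alpha> by (simp add: field_simps)
  then show ?thesis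
    unfolding cone_Lambda_def l1norm_restrict_coords norm_restrict_coords
    by (simp add: u_def v_def w_def add_divide_distrib)
qed

section \<open>Exponential moments and the score event\<close>

text \<open>A discrete layer-cake argument: as \<open>exp (1 / 2) \<le> 2\<close>, the integrand is
  at most 1 plus the sum of \<open>2 ^ m\<close> over naturals \<open>m\<close> below
  \<open>V\<close>. Against the tails this series is dominated by a geometric one with sum
  8.\<close>

lemma (in prob_space) nn_integral_exp_half_le:
  fixes V :: "'a \<Rightarrow> real"
  assumes [measurable]: "V \<in> borel_measurable M"
    and tail: "\<And>m::nat. prob {\<omega> \<in> space M. real m < V \<omega>} \<le> 2 * exp (- real m)"
  shows "(\<integral>\<^sup>+ \<omega>. ennreal (exp (V \<omega> / 2)) \<partial>M) \<le> 9"
proof -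
  define B where "B m = {\<omega> \<in> space M. real m < V \<omega>}" for m :: nat
  have [measurable]: "B m \<in> sets M" for m unfolding B_def by measurable
  have pw: "ennreal (exp (V \<omega> / 2)) \<le> 1 + (\<Sum>m. ennreal (2 ^ m) * indicator (B m) \<omega>)"
    if \<omega>: "\<omega> \<in> space M" for \<omega>
  proof -
    \<comment> \<open>For natural \<open>m\<close>, \<open>m < q\<close> means
      \<open>m < V \<omega>\<close>; if \<open>V \<omega>\<close> is nonpositive,
      \<open>q = 0\<close> and the summand 1 suffices.\<close>
    define q where "q = nat \<lceil>V \<omega>\<rceil>"
    have "exp (V \<omega> / 2) \<le> exp (real q * (1 / 2))"
      unfolding q_def by simp linarith
    also have "\<dots> = exp (1 / 2) ^ q" by (rule exp_of_nat_mult)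
    also have "\<dots> \<le> 2 ^ q" by (intro power_mono exp_half_le2) simp
    also have "\<dots> = 1 + (\<Sum>m<q. 2 ^ m)" by (simp add: sum_gp_strict)
    finally have "ennreal (exp (V \<omega> / 2)) \<le> ennreal (1 + (\<Sum>m<q. 2 ^ m))"
      by (rule ennreal_leI)
    also have "\<dots> = 1 + (\<Sum>m<q. ennreal (2 ^ m))"
      by (simp add: ennreal_plus sum_nonneg sum_ennreal del: ennreal_power)
    also have "(\<Sum>m<q. ennreal (2 ^ m)) = (\<Sum>m<q. ennreal (2 ^ m) * indicator (B m) \<omega>)"
    proof (intro sum.cong refl)
      fix m assume "m \<in> {..<q}"
      then have "real m < V \<omega>" unfolding q_def by simp linarith
      then show "ennreal (2 ^ m) = ennreal (2 ^ m) * indicator (B m) \<omega>"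
        using \<omega> by (simp add: B_def)
    qed
    also have "\<dots> \<le> (\<Sum>m. ennreal (2 ^ m) * indicator (B m) \<omega>)"
      by (rule sum_le_suminf) auto
    finally show ?thesis by (simp add: add_left_mono)
  qed
  have "(\<integral>\<^sup>+ \<omega>. ennreal (exp (V \<omega> / 2)) \<partial>M)
      \<le> (\<integral>\<^sup>+ \<omega>. 1 + (\<Sum>m. ennreal (2 ^ m) * indicator (B m) \<omega>) \<partial>M)"
    using pw by (rule nn_integral_mono)
  also have "\<dots> = 1 + (\<Sum>m. ennreal (2 ^ m) * emeasure M (B m))"
    by (simp add: nn_integral_add nn_integral_suminf nn_integral_cmult emeasure_space_1)
  also have "(\<Sum>m. ennreal (2 ^ m) * emeasure M (B m)) \<le> (\<Sum>m. ennreal (2 * (3 / 4) ^ m))"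
  proof (rule suminf_le)
    fix m
    \<comment> \<open>The resulting bound 3/8 for \<open>exp (- 1)\<close>, multiplied by the growth
      factor 2, leaves the ratio 3/4 below 1.\<close>
    have "(8 / 3 :: real) \<le> exp 1"
      using e_approx_32 by (simp add: abs_if split: if_splits)
    then have "exp (- 1) \<le> (3 / 8 :: real)"
      by (simp add: exp_minus field_simps)
    then have "exp (- 1) ^ m \<le> (3 / 8 :: real) ^ m" by (intro power_mono) auto
    moreover have "exp (- real m) = exp (- 1) ^ m" using exp_of_nat_mult[of m "- 1::real"] by simp
    ultimately have "prob (B m) \<le> 2 * (3 / 8) ^ m" using tail[of m] unfolding B_def by simp
    then have "2 ^ m * prob (B m) \<le> 2 ^ m * (2 * (3 / 8) ^ m)" by simp
    also have "\<dots> = 2 * (3 / 4) ^ m" by (simp add: power_mult_distrib[symmetric])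
    finally show "ennreal (2 ^ m) * emeasure M (B m) \<le> ennreal (2 * (3 / 4) ^ m)"
      by (simp add: emeasure_eq_measure ennreal_mult[symmetric] ennreal_leI del: ennreal_power)
  qed auto
  also have "(\<Sum>m. ennreal (2 * (3 / 4) ^ m)) = ennreal (2 * (1 / (1 - 3 / 4)))"
    by (intro suminf_ennreal_eq sums_mult geometric_sums) auto
  finally show ?thesis by (simp add: add_left_mono)
qed

text \<open>Jensen's inequality for the logarithm, by summing the tangent-line bound of
  \<open>exp\<close> at \<open>ln c\<close>.\<close>

lemma sum_le_ln_of_sum_exp_le:
  fixes V :: "'a \<Rightarrow> real"
  assumes "finite A" "0 < c" and le: "(\<Sum>j\<in>A. exp (V j)) \<le> real (card A) * c"
  shows "(\<Sum>j\<in>A. V j) \<le> real (card A) * ln c"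
proof -
  have "c * (1 + (V j - ln c)) \<le> exp (V j)" for j
  proof -
    have "c * (1 + (V j - ln c)) \<le> c * exp (V j - ln c)"
      using \<open>0 < c\<close> by (intro mult_left_mono exp_ge_add_one_self) auto
    also have "\<dots> = exp (V j)" using \<open>0 < c\<close> by (simp add: exp_diff)
    finally show ?thesis .
  qed
  then have "(\<Sum>j\<in>A. c * (1 + (V j - ln c))) \<le> (\<Sum>j\<in>A. exp (V j))" by (rule sum_mono)
  then have "c * (\<Sum>j\<in>A. 1 + (V j - ln c)) \<le> c * real (card A)"
    using le by (simp add: sum_distrib_left mult.commute)
  then have "(\<Sum>j\<in>A. 1 + (V j - ln c)) \<le> real (card A)" using \<open>0 < c\<close> by simp
  then show ?thesis by (simp add: sum.distrib sum_subtractf)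
qed

text \<open>Absorbs the logarithm from the moment bound into the product of logarithms in the
  penalty level. The factor 36 fits the constant 12 there, since 4 * 36 is its square and the
  squared-score bound carries a 4.\<close>

lemma ln_threshold_le:
  fixes p k \<delta> :: real
  assumes "0 < k" "k \<le> p" "0 < \<delta>" "\<delta> < 1"
  shows "ln (18 * p / (\<delta> * k)) \<le> 36 * (ln (2 * p * exp 1 / k) * ln (2 / \<delta>))"
    and "1 \<le> ln (2 * p * exp 1 / k)" and "0 < ln (2 / \<delta>)"
proof -
  define a b where "a = ln (2 * p * exp 1 / k)" and "b = ln (2 / \<delta>)"
  have e: "9 / 4 \<le> exp (1::real)"
    using exp_lower_Taylor_quadratic[of "1::real"] by simp
  have "a = ln (2 * (p / k)) + 1"
    using assms by (simp add: a_def ln_mult ln_div)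
  moreover have "0 \<le> ln (2 * (p / k))" using assms by (intro ln_ge_zero) (simp add: field_simps)
  ultimately have a: "1 \<le> a" by simp
  have "exp (1 / 2) \<le> 2 / \<delta>"
    by (rule order_trans[OF exp_half_le2]) (use assms in \<open>simp add: field_simps\<close>)
  then have b: "1 / 2 \<le> b" unfolding b_def using assms by (subst ln_ge_iff) auto
  have "18 * p / (\<delta> * k) = 9 * (p / k) * (2 / \<delta>)" by simp
  then have "ln (18 * p / (\<delta> * k)) = ln (9 * (p / k)) + b"
    unfolding b_def using assms ln_mult_pos[of "9 * (p / k)" "2 / \<delta>"]
    by (simp del: times_divide_eq_right times_divide_eq_left)
  \<comment> \<open>The factor 9 is at most 2 * e * e, for which 9/4 as a lower bound of e is
    enough.\<close>
  also have "ln (9 * (p / k)) \<le> ln ((2 * p * exp 1 / k) * exp 1)"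
  proof (intro ln_mono)
    have "(9 / 4) * (9 / 4) \<le> exp 1 * exp (1 :: real)" using e by (intro mult_mono) auto
    then have "9 * (p / k) \<le> 2 * (exp 1 * exp 1) * (p / k)"
      using assms by (intro mult_right_mono) auto
    then show "9 * (p / k) \<le> (2 * p * exp 1 / k) * exp 1" by (simp add: ac_simps)
  qed (use assms in auto)
  also have "\<dots> = a + 1"
    unfolding a_def using assms by (subst ln_mult_pos) auto
  finally have "ln (18 * p / (\<delta> * k)) \<le> a + 1 + b" by simp
  \<comment> \<open>Both \<open>a\<close> and 1 are at most \<open>2 * a * b\<close>, and
    \<open>b\<close> is at most \<open>a * b\<close>, so
    \<open>a + 1 + b \<le> 5 * a * b\<close>.\<close>
  moreover have "a * (1 / 2) \<le> a * b" "1 * b \<le> a * b"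
    using a b by (auto intro!: mult_mono simp del: mult_1)
  ultimately show "ln (18 * p / (\<delta> * k)) \<le> 36 * (ln (2 * p * exp 1 / k) * ln (2 / \<delta>))"
    using a b unfolding a_def[symmetric] b_def[symmetric] by linarith
  show "1 \<le> ln (2 * p * exp 1 / k)" "0 < ln (2 / \<delta>)" using a b by (auto simp: a_def b_def)
qed

text \<open>The event controls the exponential sum over all coordinates before \<open>A\<close> is
  chosen, so it serves every \<open>k\<close>-set at once, without a union bound over
  subsets.\<close>

lemma (in prob_space) subG_sum_squares_event:
  fixes Z :: "'p::finite \<Rightarrow> 'a \<Rightarrow> real"
  assumes Z: "\<And>j. subG M (Z j) v" and k: "0 < k" and \<delta>: "0 < \<delta>" "\<delta> < 1"
  obtains E where "E \<in> sets M" "1 - \<delta> / 2 \<le> prob E"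
    "\<And>\<omega> A. \<omega> \<in> E \<Longrightarrow> card A = k \<Longrightarrow>
       (\<Sum>j\<in>A. (Z j \<omega>)\<^sup>2) \<le> 4 * v * real k * ln (18 * real CARD('p) / (\<delta> * real k))"
proof -
  let ?p = "real CARD('p)"
  \<comment> \<open>Normalized so that the sub-Gaussian tail at \<open>V j \<omega> > m\<close> is
    exactly \<open>2 * exp (- m)\<close>.\<close>
  define V where "V j \<omega> = (Z j \<omega>)\<^sup>2 / (2 * v)" for j \<omega>
  have v: "0 < v" using Z by (simp add: subG_def)
  have [measurable]: "Z j \<in> borel_measurable M" for j
    using Z[of j] by (auto simp: subG_def)
  have Vm[measurable]: "V j \<in> borel_measurable M" for j unfolding V_def by measurable
  have tail: "prob {\<omega> \<in> space M. real m < V j \<omega>} \<le> 2 * exp (- real m)" for j and m :: nat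
  proof (cases "m = 0")
    case True
    then show ?thesis
      using order_trans[OF prob_le_1[of "{\<omega> \<in> space M. real m < V j \<omega>}"], of 2] by simp
  next
    case False
    have eq: "real m < V j \<omega> \<longleftrightarrow> sqrt (2 * v * real m) < \<bar>Z j \<omega>\<bar>" for \<omega>
    proof -
      have "real m < V j \<omega> \<longleftrightarrow> 2 * v * real m < (Z j \<omega>)\<^sup>2"
        using v by (simp add: V_def field_simps)
      also have "\<dots> \<longleftrightarrow> sqrt (2 * v * real m) < sqrt ((Z j \<omega>)\<^sup>2)"
        by (simp only: real_sqrt_less_iff)
      finally show ?thesis by simp
    qed
    have "0 < sqrt (2 * v * real m)" using v False by simp
    then have "prob {\<omega> \<in> space M. sqrt (2 * v * real m) < \<bar>Z j \<omega>\<bar>}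
        \<le> 2 * exp (- (sqrt (2 * v * real m))\<^sup>2 / (2 * v))"
      using Z[of j] unfolding subG_def by blast
    then show ?thesis using v by (simp add: eq)
  qed
  \<comment> \<open>The expected sum is at most \<open>9 * ?p\<close>; dividing by the failure
    probability \<open>\<delta> / 2\<close> gives this threshold.\<close>
  define E where "E = {\<omega> \<in> space M. (\<Sum>j\<in>UNIV. exp (V j \<omega> / 2)) \<le> 18 * ?p / \<delta>}"
  define F where "F = {\<omega> \<in> space M. 1 \<le> ennreal (\<delta> / (18 * ?p)) * (\<Sum>j\<in>UNIV. ennreal (exp (V j \<omega> / 2)))}"
  have [measurable]: "E \<in> sets M" "F \<in> sets M" unfolding E_def F_def by measurable
  have "emeasure M F
      \<le> ennreal (\<delta> / (18 * ?p)) * (\<integral>\<^sup>+ \<omega>. (\<Sum>j\<in>UNIV. ennreal (exp (V j \<omega> / 2))) * indicator (space M) \<omega> \<partial>M)"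
    using nn_integral_Markov_inequality[of "\<lambda>\<omega>. \<Sum>j\<in>UNIV. ennreal (exp (V j \<omega> / 2))" "space M" M
        "ennreal (\<delta> / (18 * ?p))"]
    by (simp add: F_def)
  also have "(\<integral>\<^sup>+ \<omega>. (\<Sum>j\<in>UNIV. ennreal (exp (V j \<omega> / 2))) * indicator (space M) \<omega> \<partial>M)
      = (\<integral>\<^sup>+ \<omega>. (\<Sum>j\<in>UNIV. ennreal (exp (V j \<omega> / 2))) \<partial>M)"
    by (intro nn_integral_cong) simp
  also have "\<dots> = (\<Sum>j\<in>UNIV. (\<integral>\<^sup>+ \<omega>. ennreal (exp (V j \<omega> / 2)) \<partial>M))"
    by (rule nn_integral_sum) simp
  also have "\<dots> \<le> (\<Sum>j\<in>(UNIV :: 'p set). 9)"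
    using nn_integral_exp_half_le[OF Vm tail] by (rule sum_mono)
  also have "\<dots> = ennreal (9 * ?p)"
    by (simp add: ennreal_mult ennreal_of_nat_eq_real_of_nat mult.commute)
  also have "ennreal (\<delta> / (18 * ?p)) * ennreal (9 * ?p) = ennreal (\<delta> / 2)"
    using \<delta> by (simp add: ennreal_mult[symmetric])
  finally have F: "prob F \<le> \<delta> / 2"
    using \<delta> by (simp add: emeasure_eq_measure mult_left_mono)
  have "space M - F \<subseteq> E"
  proof
    fix \<omega> assume \<omega>: "\<omega> \<in> space M - F"
    have "ennreal (\<delta> / (18 * ?p)) * (\<Sum>j\<in>UNIV. ennreal (exp (V j \<omega> / 2)))
        = ennreal (\<delta> / (18 * ?p) * (\<Sum>j\<in>UNIV. exp (V j \<omega> / 2)))"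
      using \<delta> by (subst ennreal_mult) (auto simp: sum_nonneg)
    then have "\<delta> / (18 * ?p) * (\<Sum>j\<in>UNIV. exp (V j \<omega> / 2)) < 1"
      using \<omega> by (auto simp: F_def not_le)
    then show "\<omega> \<in> E" using \<omega> \<delta> by (simp add: E_def field_simps)
  qed
  then have "prob (space M - F) \<le> prob E" by (intro finite_measure_mono) auto
  then have "1 - \<delta> / 2 \<le> prob E" using F prob_compl[of F] by simp
  moreover have "(\<Sum>j\<in>A. (Z j \<omega>)\<^sup>2) \<le> 4 * v * real k * ln (18 * ?p / (\<delta> * real k))"
    if \<omega>: "\<omega> \<in> E" and A: "card A = k" for \<omega> A
  proof -
    have "(\<Sum>j\<in>A. exp (V j \<omega> / 2)) \<le> (\<Sum>j\<in>UNIV. exp (V j \<omega> / 2))"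
      by (rule sum_mono2) auto
    also have "\<dots> \<le> 18 * ?p / \<delta>" using \<omega> by (simp add: E_def)
    \<comment> \<open>Factoring out \<open>card A\<close> puts \<open>?p / k\<close> rather than
      \<open>?p\<close> under the logarithm.\<close>
    also have "\<dots> = real (card A) * (18 * ?p / (\<delta> * real k))" using k A by simp
    finally have "(\<Sum>j\<in>A. V j \<omega> / 2) \<le> real (card A) * ln (18 * ?p / (\<delta> * real k))"
      using \<delta> k by (intro sum_le_ln_of_sum_exp_le) auto
    then have "4 * v * (\<Sum>j\<in>A. V j \<omega> / 2) \<le> 4 * v * (real k * ln (18 * ?p / (\<delta> * real k)))"
      using v A by (intro mult_left_mono) auto
    moreover have "4 * v * (\<Sum>j\<in>A. V j \<omega> / 2) = (\<Sum>j\<in>A. (Z j \<omega>)\<^sup>2)"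
      unfolding sum_distrib_left using v by (intro sum.cong) (auto simp: V_def)
    ultimately show ?thesis by (simp add: ac_simps)
  qed
  ultimately show ?thesis using that \<open>E \<in> sets M\<close> by blast
qed

section \<open>The basic inequality for the penalized minimizer\<close>

text \<open>The penalty difference is at most the drop in empirical loss, which the subgradient at
  \<open>\<beta>\<close> bounds by a linear score term; swapping sums regroups it by
  coordinates.\<close>

lemma penalized_loss_basic_inequality:
  fixes x :: "nat \<Rightarrow> real ^ 'p::finite"
  assumes le: "penalized_loss n x y f l b \<le> penalized_loss n x y f l \<beta>"
    and sub: "\<And>i t. i < n \<Longrightarrow> df (x i \<bullet> \<beta>) (y i) * (t - x i \<bullet> \<beta>) \<le> f t (y i) - f (x i \<bullet> \<beta>) (y i)"
  shows "l * (l1norm b - l1norm \<beta>)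
    \<le> (\<Sum>j\<in>UNIV. \<bar>\<Sum>i<n. df (x i \<bullet> \<beta>) (y i) * x i $ j\<bar> / real n * \<bar>(b - \<beta>) $ j\<bar>)"
proof -
  let ?Z = "\<lambda>j. \<Sum>i<n. df (x i \<bullet> \<beta>) (y i) * x i $ j"
  have "(\<Sum>j\<in>UNIV. ?Z j * (b - \<beta>) $ j) = (\<Sum>i<n. df (x i \<bullet> \<beta>) (y i) * (x i \<bullet> (b - \<beta>)))"
    unfolding inner_vec_def sum_distrib_right sum_distrib_left
    by (subst sum.swap) (simp add: ac_simps)
  also have "\<dots> \<le> (\<Sum>i<n. f (x i \<bullet> b) (y i) - f (x i \<bullet> \<beta>) (y i))"
    using sub by (intro sum_mono) (simp add: inner_diff_right)
  finally have "(\<Sum>j\<in>UNIV. ?Z j * (b - \<beta>) $ j) / real n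
      \<le> (\<Sum>i<n. f (x i \<bullet> b) (y i) - f (x i \<bullet> \<beta>) (y i)) / real n"
    by (rule divide_right_mono) simp
  also have "\<dots> \<le> l * (l1norm \<beta> - l1norm b)"
    using le by (simp add: penalized_loss_def sum_subtractf diff_divide_distrib algebra_simps)
  finally have "l * (l1norm b - l1norm \<beta>) \<le> - ((\<Sum>j\<in>UNIV. ?Z j * (b - \<beta>) $ j) / real n)"
    by (simp add: algebra_simps)
  also have "\<dots> = (\<Sum>j\<in>UNIV. - (?Z j / real n * (b - \<beta>) $ j))"
    by (simp add: sum_divide_distrib sum_distrib_right sum_negf)
  also have "\<dots> \<le> (\<Sum>j\<in>UNIV. \<bar>?Z j\<bar> / real n * \<bar>(b - \<beta>) $ j\<bar>)"
  proof (rule sum_mono)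
    fix j
    have "- (?Z j / real n * (b - \<beta>) $ j) \<le> \<bar>?Z j / real n * (b - \<beta>) $ j\<bar>"
      by (rule abs_ge_minus_self)
    then show "- (?Z j / real n * (b - \<beta>) $ j) \<le> \<bar>?Z j\<bar> / real n * \<bar>(b - \<beta>) $ j\<bar>"
      by (simp only: abs_mult abs_divide abs_of_nat)
  qed
  finally show ?thesis .
qed

section \<open>Combining the score event with the deterministic cone condition\<close>

theorem theorem2:
  fixes M :: "'w measure"
    and N :: "'y measure"
    and P :: "((real ^ 'p::finite) \<times> 'y) measure"
    and n k :: nat
    and X :: "nat \<Rightarrow> 'w \<Rightarrow> real ^ 'p"
    and Y :: "nat \<Rightarrow> 'w \<Rightarrow> 'y"
    and f df :: "real \<Rightarrow> 'y \<Rightarrow> real"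
    and \<beta>s :: "real ^ 'p"
    and \<beta>hat :: "'w \<Rightarrow> real ^ 'p"
    and L C R \<alpha> \<delta> l :: real
  assumes "prob_space M"
    and "n \<ge> 1"
    and "sets P = sets (borel \<Otimes>\<^sub>M N)"
    and "\<And>i. i < n \<Longrightarrow> (\<lambda>\<omega>. (X i \<omega>, Y i \<omega>)) \<in> measurable M P"
    and "\<And>i. i < n \<Longrightarrow> distr M P (\<lambda>\<omega>. (X i \<omega>, Y i \<omega>)) = P"
    and "\<And>\<beta>. (\<lambda>(x, y). f (x \<bullet> \<beta>) y) \<in> borel_measurable P"
    and "is_arg_min (theoretical_loss P f) (\<lambda>_. True) \<beta>s"
    and "k = l0norm \<beta>s"
    and "R = l1norm \<beta>s"
    and "R \<ge> 1"
    and A1: "\<And>t y. y \<in> space N \<Longrightarrow> f t y \<ge> 0"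
      "\<And>y. y \<in> space N \<Longrightarrow> convex_on UNIV (\<lambda>t. f t y)"
      "\<And>y. y \<in> space N \<Longrightarrow> L-lipschitz_on UNIV (\<lambda>t. f t y)"
      "\<And>t\<^sub>1 t\<^sub>2 y. y \<in> space N \<Longrightarrow> f t\<^sub>2 y - f t\<^sub>1 y \<ge> df t\<^sub>1 y * (t\<^sub>2 - t\<^sub>1)"
    and A3: "C > 0"
      "\<And>j. subG M (\<lambda>\<omega>. \<Sum>i<n. df (X i \<omega> \<bullet> \<beta>s) (Y i \<omega>) * X i \<omega> $ j) (real n * L\<^sup>2 * C\<^sup>2)"
    and "0 < \<delta>" "\<delta> < 1" "\<alpha> \<ge> 2"
    and "l = 12 * \<alpha> * L * C
               * sqrt (ln (2 * real CARD('p) * exp 1 / real k) / real n * ln (2 / \<delta>))"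
    and "\<And>\<omega>. \<omega> \<in> space M \<Longrightarrow>
           is_arg_min (penalized_loss n (\<lambda>i. X i \<omega>) (\<lambda>i. Y i \<omega>) f l)
             (\<lambda>\<beta>. l1norm \<beta> \<le> 2 * R) (\<beta>hat \<omega>)"
  shows "\<exists>E\<in>sets M. measure M E \<ge> 1 - \<delta> / 2 \<and>
           (\<forall>\<omega>\<in>E. \<forall>S\<^sub>0. top_coords k (\<beta>hat \<omega> - \<beta>s) S\<^sub>0 \<longrightarrow>
              \<beta>hat \<omega> - \<beta>s \<in> cone_Lambda S\<^sub>0 (\<alpha> / (\<alpha> - 1)) (sqrt (real k) / (\<alpha> - 1)))"
proof -
  interpret prob_space M by fact
  define a b where "a = ln (2 * real CARD('p) * exp 1 / real k)" and "b = ln (2 / \<delta>)"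
  define t where "t = 12 * L * C * sqrt (a / real n * b)"
  define Z where "Z j \<omega> = (\<Sum>i<n. df (X i \<omega> \<bullet> \<beta>s) (Y i \<omega>) * X i \<omega> $ j)" for j \<omega>
  have sp: "space P = UNIV \<times> space N"
    using sets_eq_imp_space_eq[OF assms(3)] by (simp add: space_pair_measure)
  have YN: "Y i \<omega> \<in> space N" if "i < n" "\<omega> \<in> space M" for i \<omega>
    using measurable_space[OF assms(4)[OF that(1)] that(2)] by (simp add: sp)
  have kpos: "0 < k"
  proof (rule ccontr)
    assume "\<not> 0 < k"
    then have "\<And>j. \<beta>s $ j = 0" using assms(8) by (simp add: l0norm_def)
    then show False using assms(9,10) by (simp add: l1norm_def)
  qed
  have kle: "k \<le> CARD('p)" unfolding assms(8) l0norm_def by (rule card_mono) auto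
  \<comment> \<open>\<open>subG\<close> demands a positive variance, excluding \<open>L = 0\<close>;
    the sign comes from the Lipschitz property at one sample point.\<close>
  have "0 < real n * L\<^sup>2 * C\<^sup>2" using A3(2) by (simp add: subG_def)
  then have "L \<noteq> 0" by auto
  moreover have "0 \<le> L"
  proof -
    obtain \<omega> where "\<omega> \<in> space M" using not_empty by blast
    then have "Y 0 \<omega> \<in> space N" using YN assms(2) by simp
    then show ?thesis using A1(3) by (auto simp: lipschitz_on_def)
  qed
  ultimately have L: "0 < L" by simp
  note thr = ln_threshold_le[of "real k" "real CARD('p)" \<delta>, folded a_def b_def]
  have ln_le: "ln (18 * real CARD('p) / (\<delta> * real k)) \<le> 36 * (a * b)" and a: "1 \<le> a" and b: "0 < b"
    using thr kpos kle assms(17,18) by auto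
  have t: "0 < t" unfolding t_def using L A3(1) a b assms(2) by simp
  have l: "l = \<alpha> * t" unfolding assms(20) t_def a_def b_def by simp
  \<comment> \<open>The event depends only on the scores at \<open>\<beta>s\<close>; on it the rest
    is deterministic and covers every top set that ties allow.\<close>
  obtain E where E: "E \<in> sets M" "1 - \<delta> / 2 \<le> prob E"
    "\<And>\<omega> A. \<omega> \<in> E \<Longrightarrow> card A = k \<Longrightarrow> (\<Sum>j\<in>A. (Z j \<omega>)\<^sup>2)
       \<le> 4 * (real n * L\<^sup>2 * C\<^sup>2) * real k * ln (18 * real CARD('p) / (\<delta> * real k))"
    using subG_sum_squares_event[of Z "real n * L\<^sup>2 * C\<^sup>2" k \<delta>] A3(2) kpos assms(17,18)
    unfolding Z_def by blast
  have "\<beta>hat \<omega> - \<beta>s \<in> cone_Lambda S (\<alpha> / (\<alpha> - 1)) (sqrt (real k) / (\<alpha> - 1))"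
    if \<omega>: "\<omega> \<in> E" and top: "top_coords k (\<beta>hat \<omega> - \<beta>s) S" for \<omega> S
  proof -
    have \<omega>M: "\<omega> \<in> space M" using \<omega> E(1) sets.sets_into_space by blast
    have sq: "(\<Sum>j\<in>A. (\<bar>Z j \<omega>\<bar> / real n)\<^sup>2) \<le> real k * t\<^sup>2" if A: "card A = k" for A
    proof -
      have "(\<Sum>j\<in>A. (Z j \<omega>)\<^sup>2) \<le> 4 * (real n * L\<^sup>2 * C\<^sup>2) * real k * (36 * (a * b))"
        by (rule order_trans[OF E(3)[OF \<omega> A]]) (intro mult_left_mono ln_le, simp)
      then have "(\<Sum>j\<in>A. (Z j \<omega>)\<^sup>2) / (real n)\<^sup>2
          \<le> 4 * (real n * L\<^sup>2 * C\<^sup>2) * real k * (36 * (a * b)) / (real n)\<^sup>2"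
        by (rule divide_right_mono) simp
      \<comment> \<open>Here 4 * 36 is the square of 12, and one factor \<open>n\<close> of the
        normalization cancels.\<close>
      also have "\<dots> = real k * t\<^sup>2"
        unfolding t_def power_mult_distrib using a b assms(2)
        by (simp add: field_simps power2_eq_square)
      finally show ?thesis by (simp add: sum_divide_distrib power_divide)
    qed
    \<comment> \<open>\<open>\<beta>s\<close> is a feasible competitor, as its l1 norm
      \<open>R\<close> is at most \<open>2 * R\<close>.\<close>
    have "\<not> penalized_loss n (\<lambda>i. X i \<omega>) (\<lambda>i. Y i \<omega>) f l \<beta>s
        < penalized_loss n (\<lambda>i. X i \<omega>) (\<lambda>i. Y i \<omega>) f l (\<beta>hat \<omega>)"
      using assms(21)[OF \<omega>M] assms(9,10) unfolding is_arg_min_def by auto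
    then have "l * (l1norm (\<beta>hat \<omega>) - l1norm \<beta>s)
        \<le> (\<Sum>j\<in>UNIV. \<bar>Z j \<omega>\<bar> / real n * \<bar>(\<beta>hat \<omega> - \<beta>s) $ j\<bar>)"
      unfolding Z_def using A1(4)[OF YN[OF _ \<omega>M]]
      by (intro penalized_loss_basic_inequality[where f = f]) auto
    then show ?thesis
      using cone_Lambda_of_score_bound[of \<beta>s "\<beta>hat \<omega>" S t \<alpha> "\<lambda>j. \<bar>Z j \<omega>\<bar> / real n"]
        top sq kpos t assms(19) unfolding l assms(8) by simp
  qed
  with E(1,2) show ?thesis by blast
qed

end
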